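(* Let $q\ge 2$ be even, let $\mathcal A$ be a set of size $q$, let $A_0\subset\mathcal A$ and $A_1=\mathcal A\setminus A_0$ with $|A_0|=|A_1|=q/2$. Let $(C,\overline C)$ be a partition of the vertex set $\{0,1\}^4$ of $H(4,2)$ into two induced cycles of length $8$, and let $$D=\bigcup_{(x_1,x_2,x_3,x_4)\in C}A_{x_1}\times A_{x_2}\times A_{x_3}\times A_{x_4}\subseteq\mathcal A^4.$$ Then $(D,\overline D)$ is an equitable partition of $H(4,q)$ with eigenvalue $\lambda_2(4,q)=4(q-1)-2q$.
   Context: The Hamming graph $H(n,q)$ has vertex set $\mathcal A^n$, $|\mathcal A|=q$ (with $\mathcal A=\{0,1\}$ for $q=2$ here), two tuples being adjacent iff they differ in exactly one coordinate. A partition $(C_1,C_2)$ of the vertex set of a graph into two nonempty cells is equitable with quotient matrix $S=(S_{ij})_{i,j\in\{1,2\}}$ if every vertex of $C_i$ has exactly $S_{ij}$ neighbours in $C_j$ for all $i,j$. An eigenvalue of the partition is an eigenvalue of $S$; for a $k$-regular graph these are $k$ and $S_{11}-S_{21}$, and "with eigenvalue $\lambda$" means $S_{11}-S_{21}=\lambda$. Saying a vertex set is an induced cycle of length 8 means that it has 8 elements and the subgraph it induces is a cycle. Overlines denote complements in the respective vertex set. *)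

theory Defs
  imports "HOL-Analysis.Analysis"
begin

record 'v graph =
  verts :: "'v set"
  edges :: "'v set set"

definition neighbours :: "'v graph \<Rightarrow> 'v \<Rightarrow> 'v set" where
  "neighbours G v = {w \<in> verts G. {v, w} \<in> edges G}"

definition induced :: "'v graph \<Rightarrow> 'v set \<Rightarrow> 'v graph" where
  "induced G U = \<lparr>verts = U, edges = {e \<in> edges G. e \<subseteq> U}\<rparr>"

definition is_cycle :: "'v graph \<Rightarrow> bool" where
  "is_cycle G \<longleftrightarrow>
     (let m = card (verts G) in
      m \<ge> 3 \<and>
      (\<exists>f. bij_betw f {..<m} (verts G) \<and>
           edges G = {{f i, f (Suc i mod m)} | i. i < m}))"

definition induced_cycle :: "'v graph \<Rightarrow> nat \<Rightarrow> 'v set \<Rightarrow> bool" where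
  "induced_cycle G m U \<longleftrightarrow> U \<subseteq> verts G \<and> card U = m \<and> is_cycle (induced G U)"

definition words :: "nat \<Rightarrow> 'a set \<Rightarrow> 'a list set" where
  "words n Q = {xs. length xs = n \<and> set xs \<subseteq> Q}"

definition hamming_graph :: "nat \<Rightarrow> 'a set \<Rightarrow> 'a list graph" where
  "hamming_graph n Q =
     \<lparr>verts = words n Q,
      edges = {{x, y} | x y. x \<in> words n Q \<and> y \<in> words n Q \<and>
                            card {i. i < n \<and> x ! i \<noteq> y ! i} = 1}\<rparr>"

definition equitable_bipartition :: "'v graph \<Rightarrow> real^2^2 \<Rightarrow> 'v set \<Rightarrow> 'v set \<Rightarrow> bool" where
  "equitable_bipartition G S C1 C2 \<longleftrightarrow>
     C1 \<noteq> {} \<and> C2 \<noteq> {} \<and> C1 \<inter> C2 = {} \<and> C1 \<union> C2 = verts G \<and>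
     (\<forall>v\<in>C1. real (card (neighbours G v \<inter> C1)) = S $ 1 $ 1 \<and>
             real (card (neighbours G v \<inter> C2)) = S $ 1 $ 2) \<and>
     (\<forall>v\<in>C2. real (card (neighbours G v \<inter> C1)) = S $ 2 $ 1 \<and>
             real (card (neighbours G v \<inter> C2)) = S $ 2 $ 2)"

text \<open>In a \<open>k\<close>-regular graph the rows of \<open>S\<close> sum to \<open>k\<close>, so besides the trivial eigenvalue \<open>k\<close> the
  matrix has the eigenvalue \<open>S\<^sub>1\<^sub>1 - S\<^sub>2\<^sub>1\<close> (lemma \<open>quotient_matrix_eigenvalues\<close>); this is the one
  meant when a partition is said to have eigenvalue \<open>\<mu>\<close>.\<close>

definition equitable_with_eigenvalue :: "'v graph \<Rightarrow> 'v set \<Rightarrow> 'v set \<Rightarrow> real \<Rightarrow> bool" where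
  "equitable_with_eigenvalue G C1 C2 \<mu> \<longleftrightarrow>
     (\<exists>S. equitable_bipartition G S C1 C2 \<and> S $ 1 $ 1 - S $ 2 $ 1 = \<mu>)"

lemma quotient_matrix_eigenvalues:
  fixes S :: "real^2^2"
  assumes "S $ 1 $ 1 + S $ 1 $ 2 = k" "S $ 2 $ 1 + S $ 2 $ 2 = k"
  shows "(\<exists>v. v \<noteq> 0 \<and> S *v v = \<mu> *s v) \<longleftrightarrow> \<mu> = k \<or> \<mu> = S $ 1 $ 1 - S $ 2 $ 1"
proof -
  have "(\<exists>v. v \<noteq> 0 \<and> S *v v = \<mu> *s v) \<longleftrightarrow> (\<exists>v. v \<noteq> 0 \<and> (S - mat \<mu>) *v v = 0)"
  proof -
    have "mat \<mu> *v v = \<mu> *s v" for v :: "real^2"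
      by (simp add: vec_eq_iff forall_2 matrix_vector_mult_def mat_def sum_2)
    then show ?thesis
      by (simp add: matrix_vector_mult_diff_rdistrib)
  qed
  also have "\<dots> \<longleftrightarrow> det (S - mat \<mu>) = 0"
    using invertible_det_nz[of "S - mat \<mu>"] matrix_left_invertible_ker[of "S - mat \<mu>"]
    by (metis invertible_def matrix_left_right_inverse)
  also have "det (S - mat \<mu>) = (\<mu> - k) * (\<mu> - (S $ 1 $ 1 - S $ 2 $ 1))"
  proof -
    have S: "S $ 1 $ 2 = k - S $ 1 $ 1" "S $ 2 $ 2 = k - S $ 2 $ 1"
      using assms by simp_all
    show ?thesis
      by (simp add: det_2 mat_def S) (simp add: algebra_simps)
  qed
  finally show ?thesis by auto
qed

end

theory Submission
  imports Defs
begin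

text \<open>An induced cycle is 2-regular, so both cells of the 4-regular graph \<open>H(4,2)\<close> have two neighbours
  in either cell, and every entry of the quotient matrix is 2. The map \<open>Q \<rightarrow> {0,1}\<close> with fibres
  \<open>A 0\<close> and \<open>A 1\<close> pulls the partition back to \<open>H(4,q)\<close>. Replacing a letter by another one of the
  same fibre does not change the cell, and each edge at the image vertex lifts to \<open>r = q/2\<close> edges,
  so a pullback along fibres of size \<open>r\<close> turns a quotient matrix \<open>S\<close> into \<open>n (r - 1) I + r S\<close>.\<close>

subsection \<open>Cycles\<close>

text \<open>Along the cyclic enumeration \<open>f\<close>, the vertex \<open>f k\<close> is joined
  exactly to its predecessor and its successor, and these are distinct.\<close>

lemma card_neighbours_cycle:
  assumes "is_cycle G" and "v \<in> verts G"
  shows "card (neighbours G v) = 2"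
proof -
  define m where "m = card (verts G)"
  obtain f where m: "m \<ge> 3" and f: "bij_betw f {..<m} (verts G)"
    and E: "edges G = {{f i, f (Suc i mod m)} | i. i < m}"
    using assms(1) unfolding is_cycle_def Let_def m_def by blast
  have inj: "f i = f j \<longleftrightarrow> i = j" if "i < m" "j < m" for i j
    using f that by (auto simp: bij_betw_def inj_on_def)
  obtain k where k: "k < m" "v = f k"
    using f assms(2) by (auto simp: bij_betw_def)
  \<comment> \<open>The cyclic predecessor of \<open>k\<close>; the case \<open>k = 0\<close> wraps
    around to \<open>m - 1\<close>.\<close>
  define p where "p = (if k = 0 then m - 1 else k - 1)"
  have p: "p < m" and s: "Suc k mod m < m"
    using m k by (auto simp: p_def)
  have pred: "Suc j mod m = k \<longleftrightarrow> j = p" if "j < m" for j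
    using that m k by (auto simp: p_def mod_Suc split: if_splits)
  \<comment> \<open>For \<open>m = 2\<close> predecessor and successor would coincide;
    \<open>m \<ge> 3\<close> separates them.\<close>
  have sp: "Suc k mod m \<noteq> p"
    using m k by (auto simp: p_def mod_Suc)
  have ran: "f i \<in> verts G" if "i < m" for i
    using f that by (auto simp: bij_betw_def)
  have edge: "{v, f j} \<in> edges G \<longleftrightarrow> j = p \<or> j = Suc k mod m" if j: "j < m" for j
  proof -
    have "{v, f j} \<in> edges G \<longleftrightarrow> (\<exists>i<m. {f k, f j} = {f i, f (Suc i mod m)})"
      unfolding E k(2) by blast
    \<comment> \<open>An unordered pair can match in two orientations: the first makes
      \<open>j\<close> the successor of \<open>k\<close>, the second its predecessor.\<close>
    also have "\<dots> \<longleftrightarrow> (\<exists>i<m. k = i \<and> j = Suc i mod m \<or> k = Suc i mod m \<and> j = i)"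
      using j k m by (intro ex_cong1 conj_cong refl) (auto simp: doubleton_eq_iff inj)
    also have "\<dots> \<longleftrightarrow> j = p \<or> j = Suc k mod m"
      using pred j k by auto
    finally show ?thesis .
  qed
  have "neighbours G v = {f p, f (Suc k mod m)}"
  proof (intro set_eqI)
    fix w
    show "w \<in> neighbours G v \<longleftrightarrow> w \<in> {f p, f (Suc k mod m)}"
    proof (cases "w \<in> verts G")
      case True
      then obtain j where "j < m" "w = f j"
        using f by (auto simp: bij_betw_def)
      then show ?thesis
        using edge[of j] p s True by (auto simp: neighbours_def inj)
    next
      case False
      then show ?thesis
        using ran[OF p] ran[OF s] by (auto simp: neighbours_def)
    qed
  qed
  then show ?thesis
    using sp p s by (simp add: inj)
qed

lemma card_neighbours_induced_cycle:
  assumes "induced_cycle G m U" and "v \<in> U"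
  shows "card (neighbours G v \<inter> U) = 2"
proof -
  have "neighbours (induced G U) v = neighbours G v \<inter> U"
    using assms by (auto simp: neighbours_def induced_def induced_cycle_def)
  moreover have "v \<in> verts (induced G U)"
    using assms(2) by (simp add: induced_def)
  ultimately show ?thesis
    using card_neighbours_cycle assms(1) by (metis induced_cycle_def)
qed

subsection \<open>Neighbours in Hamming graphs\<close>

lemma verts_hamming_graph [simp]: "verts (hamming_graph n Q) = words n Q"
  by (simp add: hamming_graph_def)

lemma list_update_in_words: "x \<in> words n Q \<Longrightarrow> b \<in> Q \<Longrightarrow> x[i := b] \<in> words n Q"
  using set_update_subset_insert[of x i b] by (fastforce simp: words_def)

text \<open>The single position where a neighbour differs, together with its letter there,
  determines it. Counting neighbours thus becomes counting letters position by position.\<close>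

lemma neighbours_hamming_graph:
  assumes x: "x \<in> words n Q"
  shows "neighbours (hamming_graph n Q) x = (\<Union>i<n. (\<lambda>b. x[i := b]) ` (Q - {x ! i}))"
proof -
  have "neighbours (hamming_graph n Q) x =
      {y \<in> words n Q. card {i. i < n \<and> x ! i \<noteq> y ! i} = 1}"
  proof -
    \<comment> \<open>Edges are unordered pairs, so the differing positions must not depend on the
      order of the two words.\<close>
    have "{i. i < n \<and> x ! i \<noteq> y ! i} = {i. i < n \<and> y ! i \<noteq> x ! i}" for y
      by auto
    then show ?thesis
      using x by (auto simp: neighbours_def hamming_graph_def doubleton_eq_iff)
  qed
  also have "\<dots> = (\<Union>i<n. (\<lambda>b. x[i := b]) ` (Q - {x ! i}))"
  proof (intro equalityI subsetI)
    fix y assume "y \<in> {y \<in> words n Q. card {i. i < n \<and> x ! i \<noteq> y ! i} = 1}"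
    then obtain i where y: "y \<in> words n Q" and i: "{i. i < n \<and> x ! i \<noteq> y ! i} = {i}"
      by (auto simp: card_1_singleton_iff)
    then have "i < n" "x ! i \<noteq> y ! i" and eq: "\<And>j. j < n \<Longrightarrow> j \<noteq> i \<Longrightarrow> x ! j = y ! j"
      by blast+
    moreover have "y ! j = x[i := y ! i] ! j" if "j < n" for j
      using that x eq[of j] by (cases "j = i") (auto simp: words_def)
    then have "y = x[i := y ! i]"
      using x y by (simp add: words_def list_eq_iff_nth_eq)
    moreover have "y ! i \<in> Q"
      using y \<open>i < n\<close> by (auto simp: words_def)
    ultimately show "y \<in> (\<Union>i<n. (\<lambda>b. x[i := b]) ` (Q - {x ! i}))"
      by (intro UN_I[of i] image_eqI[of _ _ "y ! i"]) auto
  next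
    fix y assume "y \<in> (\<Union>i<n. (\<lambda>b. x[i := b]) ` (Q - {x ! i}))"
    then obtain i b where i: "i < n" and b: "b \<in> Q" "b \<noteq> x ! i" and y: "y = x[i := b]"
      by auto
    have "{j. j < n \<and> x ! j \<noteq> y ! j} = {i}"
      using i b x by (auto simp: y words_def nth_list_update)
    then show "y \<in> {y \<in> words n Q. card {i. i < n \<and> x ! i \<noteq> y ! i} = 1}"
      using list_update_in_words[OF x b(1)] y by simp
  qed
  finally show ?thesis .
qed

text \<open>Changes at different positions give different words, and at a fixed position the new
  letter can be read off the word, so the union is disjoint and each map is injective.\<close>

lemma card_neighbours_hamming_graph_Int:
  assumes "finite Q" and x: "x \<in> words n Q"
  shows "card (neighbours (hamming_graph n Q) x \<inter> U) =
    (\<Sum>i<n. card {b \<in> Q - {x ! i}. x[i := b] \<in> U})"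
proof -
  let ?B = "\<lambda>i. {b \<in> Q - {x ! i}. x[i := b] \<in> U}"
  have len: "length x = n"
    using x by (simp add: words_def)
  have "neighbours (hamming_graph n Q) x \<inter> U = (\<Union>i<n. (\<lambda>b. x[i := b]) ` ?B i)"
    unfolding neighbours_hamming_graph[OF x] by blast
  also have "card \<dots> = (\<Sum>i<n. card ((\<lambda>b. x[i := b]) ` ?B i))"
  proof (intro card_UN_disjoint ballI impI)
    fix i j assume "i \<in> {..<n}" "j \<in> {..<n}" "i \<noteq> j"
    moreover have False if "x[i := b] = x[j := c]" "b \<noteq> x ! i" "i < n" "i \<noteq> j" for b c
      using that len by (metis nth_list_update_eq nth_list_update_neq)
    ultimately show "(\<lambda>b. x[i := b]) ` ?B i \<inter> (\<lambda>b. x[j := b]) ` ?B j = {}"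
      by blast
  qed (use assms in auto)
  also have "\<dots> = (\<Sum>i<n. card (?B i))"
  proof (intro sum.cong refl card_image inj_onI)
    fix i b c assume "i \<in> {..<n}" "x[i := b] = x[i := c]"
    then show "b = c"
      using len by (metis lessThan_iff nth_list_update_eq)
  qed
  finally show ?thesis .
qed

lemma card_neighbours_hamming_graph:
  assumes "finite Q" and x: "x \<in> words n Q"
  shows "card (neighbours (hamming_graph n Q) x) = n * (card Q - 1)"
proof -
  have "card (Q - {x ! i}) = card Q - 1" if "i < n" for i
    using that x by (intro card_Diff_singleton) (auto simp: words_def)
  \<comment> \<open>Intersecting with \<open>UNIV\<close> makes the degree an instance of the
    preceding count.\<close>
  then have "card (neighbours (hamming_graph n Q) x \<inter> UNIV) = (\<Sum>i<n. card Q - 1)"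
    unfolding card_neighbours_hamming_graph_Int[OF assms]
    by (intro sum.cong) (simp_all only: UNIV_I simp_thms Collect_mem_eq lessThan_iff)
  then show ?thesis by simp
qed

subsection \<open>Pulling back along maps of alphabets\<close>

lemma card_fibres:
  assumes "finite T" and "\<And>c. c \<in> T \<Longrightarrow> card {a \<in> Q. \<phi> a = c} = r" and "r > 0"
  shows "card {a \<in> Q. \<phi> a \<in> T} = r * card T"
proof -
  \<comment> \<open>Infinite sets have \<open>card\<close> 0, so a fibre of positive cardinality is
    finite.\<close>
  have "finite {a \<in> Q. \<phi> a = c}" if "c \<in> T" for c
    using assms(2)[OF that] assms(3) by (simp add: card_ge_0_finite)
  then have "card (\<Union>c\<in>T. {a \<in> Q. \<phi> a = c}) = (\<Sum>c\<in>T. card {a \<in> Q. \<phi> a = c})"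
    using assms(1) by (intro card_UN_disjoint) auto
  also have "\<dots> = r * card T"
    using assms(2) by simp
  also have "(\<Union>c\<in>T. {a \<in> Q. \<phi> a = c}) = {a \<in> Q. \<phi> a \<in> T}"
    by blast
  finally show ?thesis .
qed

text \<open>A new letter from another fibre moves the image to a neighbour, and each such move has
  \<open>r\<close> lifts. The \<open>r - 1\<close> other letters of the same fibre leave the image
  fixed, so at each of the \<open>n\<close> positions they count only if the image of
  \<open>y\<close> lies in \<open>C\<close>.\<close>

lemma card_neighbours_pullback:
  fixes r :: nat
  assumes fin: "finite Q" "finite R" and \<phi>: "\<phi> ` Q \<subseteq> R"
    and fibre: "\<And>c. c \<in> R \<Longrightarrow> card {a \<in> Q. \<phi> a = c} = r" and r: "r > 0"
    and y: "y \<in> words n Q"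
  shows "card (neighbours (hamming_graph n Q) y \<inter> {z \<in> words n Q. map \<phi> z \<in> C}) =
    r * card (neighbours (hamming_graph n R) (map \<phi> y) \<inter> C) +
    (if map \<phi> y \<in> C then n * (r - 1) else 0)"
proof -
  let ?x = "map \<phi> y"
  let ?e = "if ?x \<in> C then r - 1 else 0"
  have x: "?x \<in> words n R"
    using y \<phi> by (auto simp: words_def)
  have "card {b \<in> Q - {y ! i}. y[i := b] \<in> {z \<in> words n Q. map \<phi> z \<in> C}} =
      r * card {c \<in> R - {?x ! i}. ?x[i := c] \<in> C} + ?e" if i: "i < n" for i
  proof -
    let ?T = "{c \<in> R - {?x ! i}. ?x[i := c] \<in> C}"
    let ?F = "{b \<in> Q - {y ! i}. \<phi> b = \<phi> (y ! i) \<and> ?x \<in> C}"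
    have yi: "y ! i \<in> Q" "?x ! i = \<phi> (y ! i)"
      using y i by (auto simp: words_def)
    have self: "?x[i := \<phi> (y ! i)] = ?x"
      by (simp add: map_update[symmetric])
    \<comment> \<open>The replacement letters are split by whether they leave the fibre of
      \<open>y ! i\<close>; since \<open>?T\<close> excludes \<open>?x ! i\<close>, the two parts
      are disjoint.\<close>
    have "{b \<in> Q - {y ! i}. y[i := b] \<in> {z \<in> words n Q. map \<phi> z \<in> C}} =
        {b \<in> Q. \<phi> b \<in> ?T} \<union> ?F"
      using \<phi> yi y self list_update_in_words[OF y] by (auto simp: map_update)
    also have "card \<dots> = card {b \<in> Q. \<phi> b \<in> ?T} + card ?F"
      using fin yi by (intro card_Un_disjoint) auto
    also have "card {b \<in> Q. \<phi> b \<in> ?T} = r * card ?T"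
      using fin r fibre by (intro card_fibres) auto
    also have "card ?F = ?e"
    proof (cases "?x \<in> C")
      case True
      then have "?F = {b \<in> Q. \<phi> b = \<phi> (y ! i)} - {y ! i}"
        by auto
      then show ?thesis
        using True yi \<phi> fibre[of "\<phi> (y ! i)"] fin by (auto simp: card_Diff_singleton)
    qed simp
    finally show ?thesis .
  qed
  then have "card (neighbours (hamming_graph n Q) y \<inter> {z \<in> words n Q. map \<phi> z \<in> C}) =
      (\<Sum>i<n. r * card {c \<in> R - {?x ! i}. ?x[i := c] \<in> C} + ?e)"
    unfolding card_neighbours_hamming_graph_Int[OF fin(1) y] by (intro sum.cong) auto
  also have "\<dots> = r * card (neighbours (hamming_graph n R) ?x \<inter> C) + n * ?e"
    unfolding card_neighbours_hamming_graph_Int[OF fin(2) x]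
    by (simp add: sum.distrib sum_distrib_left)
  finally show ?thesis by simp
qed

text \<open>Neighbours with unchanged image stay in the cell of the vertex, which gives the scalar
  matrix; lifted edges scale \<open>S\<close> by \<open>r\<close>. Hence
  \<open>S $ 1 $ 1 - S $ 2 $ 1\<close> is multiplied by \<open>r\<close> and shifted by
  \<open>n * (r - 1)\<close>.\<close>

lemma equitable_bipartition_pullback:
  fixes r :: nat
  assumes fin: "finite Q" "finite R" and \<phi>: "\<phi> ` Q \<subseteq> R"
    and fibre: "\<And>c. c \<in> R \<Longrightarrow> card {a \<in> Q. \<phi> a = c} = r" and r: "r > 0"
    and eq: "equitable_bipartition (hamming_graph n R) S C1 C2"
  shows "equitable_bipartition (hamming_graph n Q) (mat (real (n * (r - 1))) + real r *\<^sub>R S)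
    {y \<in> words n Q. map \<phi> y \<in> C1} {y \<in> words n Q. map \<phi> y \<in> C2}"
proof -
  have disj: "C1 \<inter> C2 = {}" and cover: "C1 \<union> C2 = words n R" and ne: "C1 \<noteq> {}" "C2 \<noteq> {}"
    using eq by (auto simp: equitable_bipartition_def)
  \<comment> \<open>Surjectivity of \<open>\<phi>\<close> onto \<open>R\<close> lets words be lifted
    letter by letter, so that both preimages are nonempty.\<close>
  have "\<exists>a\<in>Q. \<phi> a = c" if "c \<in> R" for c
    using fibre[OF that] r by (metis (mono_tags, lifting) card.empty empty_Collect_eq less_irrefl)
  then have "R \<subseteq> \<phi> ` Q" by blast
  have lift: "\<exists>y\<in>words n Q. map \<phi> y = x" if "x \<in> words n R" for x
  proof -
    have "x \<in> lists (\<phi> ` Q)"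
      using that \<open>R \<subseteq> \<phi> ` Q\<close> by (auto simp: words_def)
    then obtain y where "y \<in> lists Q" "x = map \<phi> y"
      by (auto simp: lists_image)
    then show ?thesis
      using that by (auto simp: words_def)
  qed
  have map: "map \<phi> y \<in> words n R" if "y \<in> words n Q" for y
    using that \<phi> by (auto simp: words_def)
  note nb = card_neighbours_pullback[OF fin \<phi> fibre r]
  have nonempty: "{y \<in> words n Q. map \<phi> y \<in> C1} \<noteq> {}" "{y \<in> words n Q. map \<phi> y \<in> C2} \<noteq> {}"
    using ne cover lift by blast+
  have union: "{y \<in> words n Q. map \<phi> y \<in> C1} \<union> {y \<in> words n Q. map \<phi> y \<in> C2} = words n Q"
    using cover map by blast
  \<comment> \<open>Settles the conditional in \<open>nb\<close> when neighbours in the opposite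
    cell are counted.\<close>
  have mem2: "x \<notin> C2" if "x \<in> C1" for x
    using disj that by blast
  show ?thesis
    unfolding equitable_bipartition_def
    using eq disj nonempty union
    by (auto simp: nb mem2 equitable_bipartition_def mat_def)
qed

section \<open>Products of fibres as preimages\<close>

lemma list_in_listset_iff: "y \<in> listset As \<longleftrightarrow> list_all2 (\<in>) y As"
  by (induction As arbitrary: y) (auto simp: set_Cons_def list_all2_Cons2)

lemma Union_listset_fibres:
  assumes "C \<subseteq> words n R" and "\<And>c. c \<in> R \<Longrightarrow> A c = {a \<in> Q. \<phi> a = c}"
  shows "(\<Union>x\<in>C. listset (map A x)) = {y \<in> words n Q. map \<phi> y \<in> C}"
proof -
  have "y \<in> listset (map A x) \<longleftrightarrow> y \<in> words n Q \<and> map \<phi> y = x" if "x \<in> C" for x y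
  proof -
    have x: "length x = n" "set x \<subseteq> R"
      using assms(1) that by (auto simp: words_def)
    have A: "A (x ! i) = {a \<in> Q. \<phi> a = x ! i}" if "i < n" for i
      using x that by (intro assms(2)) auto
    have "y \<in> listset (map A x) \<longleftrightarrow> length y = n \<and> (\<forall>i<n. y ! i \<in> A (x ! i))"
      using x by (auto simp: list_in_listset_iff list_all2_conv_all_nth)
    also have "\<dots> \<longleftrightarrow> length y = n \<and> (\<forall>i<n. y ! i \<in> Q \<and> \<phi> (y ! i) = x ! i)"
      using A by simp
    also have "\<dots> \<longleftrightarrow> y \<in> words n Q \<and> map \<phi> y = x"
      using x by (fastforce simp: words_def list_eq_iff_nth_eq in_set_conv_nth)
    finally show ?thesis .
  qed
  then show ?thesis by auto
qed

theorem corollary2: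
  fixes q :: nat and Q :: "'a set" and A :: "nat \<Rightarrow> 'a set" and C :: "nat list set" and D :: "'a list set"
  assumes "q \<ge> 2" and "even q"
    and "card Q = q"
    and "A 0 \<subseteq> Q" and "A 1 = Q - A 0"
    and "card (A 0) = q div 2" and "card (A 1) = q div 2"
    and "C \<subseteq> words 4 {0, 1}"
    and "induced_cycle (hamming_graph 4 {0, 1}) 8 C"
    and "induced_cycle (hamming_graph 4 {0, 1}) 8 (words 4 {0, 1} - C)"
    and "D = (\<Union>x\<in>C. listset (map A x))"
  shows "equitable_with_eigenvalue (hamming_graph 4 Q) D (words 4 Q - D)
           (4 * (real q - 1) - 2 * real q)"
proof -
  let ?H = "hamming_graph 4 {0, 1 :: nat}"
  let ?C' = "words 4 {0, 1} - C"
  \<comment> \<open>Letters outside \<open>Q\<close> also get the value 1, which is harmless because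
    all fibres are taken within \<open>Q\<close>.\<close>
  define \<phi> :: "'a \<Rightarrow> nat" where "\<phi> a = (if a \<in> A 0 then 0 else 1)" for a
  have fibre: "A c = {a \<in> Q. \<phi> a = c}" if "c \<in> {0, 1}" for c
    using that assms(4,5) by (auto simp: \<phi>_def)
  have finQ: "finite Q"
    using assms(1,3) by (intro card_ge_0_finite) simp
  have r: "q div 2 > 0"
    using assms(1) by simp
  have card_fibre: "card {a \<in> Q. \<phi> a = c} = q div 2" if "c \<in> {0, 1}" for c
    using fibre[OF that, symmetric] that assms(6,7) by auto
  have \<phi>: "\<phi> ` Q \<subseteq> {0, 1}"
    by (auto simp: \<phi>_def)
  have map: "map \<phi> y \<in> words 4 {0, 1}" if "y \<in> words 4 Q" for y
    using that by (auto simp: words_def \<phi>_def)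
  have D: "D = {y \<in> words 4 Q. map \<phi> y \<in> C}"
    using Union_listset_fibres[OF assms(8) fibre] assms(11) by simp
  have D': "words 4 Q - D = {y \<in> words 4 Q. map \<phi> y \<in> ?C'}"
    unfolding D using map by blast
  \<comment> \<open>The cycles determine only the neighbours within a vertex's own cell; the degree
    4 then yields those in the other cell.\<close>
  have deg: "card (neighbours ?H v \<inter> C) + card (neighbours ?H v \<inter> ?C') = 4"
    if "v \<in> words 4 {0, 1}" for v
  proof -
    have "neighbours ?H v \<subseteq> words 4 {0, 1}"
      by (auto simp: neighbours_def)
    then have "neighbours ?H v = (neighbours ?H v \<inter> C) \<union> (neighbours ?H v \<inter> ?C')"
      by blast
    moreover have "card (neighbours ?H v) = 4"
      using card_neighbours_hamming_graph[OF _ that] by simp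
    moreover from this have "finite (neighbours ?H v)"
      by (intro card_ge_0_finite) simp
    moreover have "(neighbours ?H v \<inter> C) \<inter> (neighbours ?H v \<inter> ?C') = {}"
      by blast
    ultimately show ?thesis
      by (metis card_Un_disjoint finite_Int)
  qed
  have inC: "card (neighbours ?H v \<inter> C) = 2" "card (neighbours ?H v \<inter> ?C') = 2" if "v \<in> C" for v
    using card_neighbours_induced_cycle[OF assms(9) that] deg[of v] that assms(8) by auto
  have inC': "card (neighbours ?H v \<inter> C) = 2" "card (neighbours ?H v \<inter> ?C') = 2" if "v \<in> ?C'" for v
    using card_neighbours_induced_cycle[OF assms(10) that] deg[of v] that by auto
  have "C \<noteq> {}" "?C' \<noteq> {}"
    using assms(9,10) by (force simp: induced_cycle_def)+
  then have "equitable_bipartition ?H (\<chi> i j. 2) C ?C'"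
    unfolding equitable_bipartition_def using assms(8) inC inC' by auto
  then have "equitable_bipartition (hamming_graph 4 Q)
      (mat (real (4 * (q div 2 - 1))) + real (q div 2) *\<^sub>R (\<chi> i j. 2)) D (words 4 Q - D)"
    \<comment> \<open>\<open>D'\<close> comes first because its left-hand side mentions
      \<open>D\<close>.\<close>
    unfolding D' unfolding D using finQ \<phi> card_fibre r
    by (intro equitable_bipartition_pullback[where R = "{0, 1}"]) auto
  \<comment> \<open>The constant matrix contributes 0 to the difference of the rows, so the
    eigenvalue is the diagonal term \<open>4 * (q/2 - 1) = 2 * q - 4\<close>. Evenness makes
    \<open>div\<close> exact, and \<open>q \<ge> 2\<close> keeps the natural subtraction from
    truncating.\<close>
  moreover have "real (4 * (q div 2 - 1)) = 4 * (real q - 1) - 2 * real q"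
    using assms(1,2) by (auto elim!: evenE simp: of_nat_diff)
  ultimately show ?thesis
    unfolding equitable_with_eigenvalue_def by (intro exI conjI) (auto simp: mat_def)
qed

end
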